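(* Let $(X,d)$ be a compact metric space and let $T:X\to 2^X$ be upper semi-continuous, open and expanding. Let $\alpha\in(0,1]$. For any $\alpha$-Hölder function $f:X\to\mathbb{R}$ there exists an $\alpha$-Hölder function $v:X\to\mathbb{R}$ such that $$f(x)+v(x)-v(y)\le\beta(X,T,f)\quad\text{for all }(x,y)\in gr(T).$$
   Context: $2^X$ is the set of all subsets of $X$ (the value $\emptyset$ is allowed). $T:X\to2^X$ is upper semi-continuous if for every $x\in X$ and every open $V\supseteq T(x)$ there is an open $U\ni x$ with $T(u)\subseteq V$ for all $u\in U$. It is open if $T(A):=\bigcup_{x\in A}T(x)$ is open in $X$ for every open $A\subseteq X$. It is expanding (with respect to $d$) if there exist $\lambda>1$ and $\eta>0$ such that for all $x,y\in X$ with $d(x,y)\le\eta$ one has $\inf\{d(x',y'):x'\in T(x),\,y'\in T(y)\}\ge\lambda d(x,y)$ (with $\inf\emptyset=+\infty$). The graph is $gr(T)=\{(x,x')\in X^2:x'\in T(x)\}$. A Borel probability measure $\mu$ on $X$ is $T$-invariant if $\mu(A)\le\mu(T^{-1}(A))$ for all Borel $A\subseteq X$, where $T^{-1}(A)=\{x\in X:T(x)\cap A\neq\emptyset\}$ (a universally measurable set, measured via the completion of $\mu$). The maximum ergodic average is $\beta(X,T,f)=\sup\{\int f\,d\mu:\mu\text{ is }T\text{-invariant}\}$, with the convention $\sup\emptyset=-\infty$. A function $g:X\to\mathbb{R}$ is $\alpha$-Hölder if there is $K>0$ with $|g(z)-g(z')|\le K d(z,z')^\alpha$ for all $z,z'\in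 X$.
   Formalization: Two hypotheses are added, without which the claim is false: every value T(x) is closed in X, and either β(X,T,f) is not −∞ (i.e. a T-invariant measure exists) or gr(T) is empty. *)

theory Defs
  imports "HOL-Probability.Probability"
begin

text \<open>
  The metric space is a subset \<open>X\<close> of a type of class \<^class>\<open>metric_space\<close>, with the
  distance of the type; open means open in \<open>X\<close>. A multivalued map on \<open>X\<close> is a function
  \<open>T\<close> with \<open>T x \<subseteq> X\<close> for \<open>x \<in> X\<close>, where \<open>T x = {}\<close> is allowed. The values of functions and
  maps outside \<open>X\<close> play no role.
\<close>

definition multimap_on :: "'a set \<Rightarrow> ('a \<Rightarrow> 'a set) \<Rightarrow> bool" where
  "multimap_on X T \<longleftrightarrow> (\<forall>x\<in>X. T x \<subseteq> X)"

definition graph_on :: "'a set \<Rightarrow> ('a \<Rightarrow> 'a set) \<Rightarrow> ('a \<times> 'a) set" where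
  "graph_on X T = {(x, x'). x \<in> X \<and> x' \<in> X \<and> x' \<in> T x}"

definition usc_on :: "'a::topological_space set \<Rightarrow> ('a \<Rightarrow> 'a set) \<Rightarrow> bool" where
  "usc_on X T \<longleftrightarrow>
    (\<forall>x\<in>X. \<forall>V. openin (top_of_set X) V \<and> T x \<subseteq> V \<longrightarrow>
      (\<exists>U. openin (top_of_set X) U \<and> x \<in> U \<and> (\<forall>u\<in>U. T u \<subseteq> V)))"

definition open_multimap_on :: "'a::topological_space set \<Rightarrow> ('a \<Rightarrow> 'a set) \<Rightarrow> bool" where
  "open_multimap_on X T \<longleftrightarrow>
    (\<forall>A. openin (top_of_set X) A \<longrightarrow> openin (top_of_set X) (\<Union>x\<in>A. T x))"

text \<open>The infimum is taken in \<^typ>\<open>ereal\<close>, so that it is \<open>\<infinity>\<close> if \<open>T x\<close> or \<open>T y\<close> is empty.\<close>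

definition expanding_on :: "'a::metric_space set \<Rightarrow> ('a \<Rightarrow> 'a set) \<Rightarrow> bool" where
  "expanding_on X T \<longleftrightarrow>
    (\<exists>lam>1. \<exists>\<eta>>0. \<forall>x\<in>X. \<forall>y\<in>X. dist x y \<le> \<eta> \<longrightarrow>
      (INF (x', y')\<in>T x \<times> T y. ereal (dist x' y')) \<ge> ereal (lam * dist x y))"

definition preimage_on :: "'a set \<Rightarrow> ('a \<Rightarrow> 'a set) \<Rightarrow> 'a set \<Rightarrow> 'a set" where
  "preimage_on X T A = {x \<in> X. T x \<inter> A \<noteq> {}}"

text \<open>
  The preimage of a Borel set need not be Borel. For the maps considered here (upper
  semi-continuous, open and expanding on a compact space) it is a finite union of Lipschitz
  images of Borel sets, hence analytic and measurable for the completion of every Borel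
  probability measure, so the value \<open>0\<close> that \<^const>\<open>emeasure\<close> gives to non-measurable sets does
  not occur.
\<close>

definition invariant_measure_on ::
    "'a::topological_space set \<Rightarrow> ('a \<Rightarrow> 'a set) \<Rightarrow> 'a measure \<Rightarrow> bool" where
  "invariant_measure_on X T \<mu> \<longleftrightarrow>
    prob_space \<mu> \<and> sets \<mu> = sets (restrict_space borel X) \<and>
    (\<forall>A\<in>sets \<mu>. emeasure \<mu> A \<le> emeasure (completion \<mu>) (preimage_on X T A))"

text \<open>
  In \<^typ>\<open>ereal\<close> the supremum of the empty set is \<open>-\<infinity>\<close>. This value does occur when values
  of \<open>T\<close> may be empty: for \<open>X = {a, b}\<close>, \<open>T a = {b}\<close>, \<open>T b = {}\<close> no invariant measure exists.
  An upper bound by it is impossible for real-valued expressions.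
\<close>

definition max_ergodic_average ::
    "'a::topological_space set \<Rightarrow> ('a \<Rightarrow> 'a set) \<Rightarrow> ('a \<Rightarrow> real) \<Rightarrow> ereal" where
  "max_ergodic_average X T f =
    (SUP \<mu>\<in>{\<mu>. invariant_measure_on X T \<mu>}. ereal (integral\<^sup>L \<mu> f))"

definition holder_on :: "real \<Rightarrow> 'a::metric_space set \<Rightarrow> ('a \<Rightarrow> real) \<Rightarrow> bool" where
  "holder_on \<alpha> X g \<longleftrightarrow>
    (\<exists>K>0. \<forall>z\<in>X. \<forall>z'\<in>X. \<bar>g z - g z'\<bar> \<le> K * dist z z' powr \<alpha>)"

end

theory Submission
  imports Defs
begin

text \<open>
  Write \<open>b\<close> for the maximum ergodic average and call a finite sequence \<open>x\<^sub>0, \<dots>, x\<^sub>n\<close> whose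
  consecutive pairs lie in the graph an orbit segment. The function that solves the inequality is
  the value of an optimal control problem run backwards in time: \<open>v y\<close> is the supremum of the sums
  of \<open>f - b\<close> along all orbit segments that end in \<open>y\<close>. Appending an edge \<open>(x, y)\<close> to a segment
  that ends in \<open>x\<close> gives \<open>v y \<ge> v x + f x - b\<close>, which is the claim. It remains to see that \<open>v\<close> is
  finite and Hoelder continuous.

  Expansion and openness, together with compactness of the graph, say that near every edge of the
  graph the inverse of \<open>T\<close> has a branch that contracts by a fixed factor, on balls of a fixed radius
  (\<open>contracting_inverse_onI_expanding\<close>). A segment can therefore be pulled back along any small
  change of its end point, and the two segments approach each other geometrically backwards in time
  (\<open>orbit_segment_shadow\<close>). Their sums of the Hoelder function \<open>f\<close> then differ by at most a
  constant times the \<open>\<alpha>\<close>-th power of the distance of the end points, whatever their length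
  (\<open>birkhoff_sum_holder\<close>). This gives the Hoelder bound for \<open>v\<close>.

  For finiteness, iterating the pull-back along a segment whose two ends are close converges to a
  periodic orbit that shadows the segment (\<open>orbit_segment_closing\<close>). The uniform measure on a
  periodic orbit is invariant, so the average of \<open>f\<close> along it is at most \<open>b\<close>
  (\<open>periodic_average_le_max_ergodic_average\<close>). Hence the sum of \<open>f - b\<close> is bounded by a constant
  along every segment with close ends. An arbitrary segment splits into at most \<open>N\<close> such pieces and
  \<open>N\<close> single points, where \<open>N\<close> is the number of small balls that cover \<open>X\<close>
  (\<open>sum_bounded_by_recurrence\<close>), so all sums of \<open>f - b\<close> have a common upper bound.
\<close>

section \<open>Inverse branches\<close>

lemma expanding_onE:
  assumes "expanding_on X T"
  obtains lam \<eta> where "lam > 1" "\<eta> > 0"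
    "\<And>x y x' y'. x \<in> X \<Longrightarrow> y \<in> X \<Longrightarrow> dist x y \<le> \<eta> \<Longrightarrow> x' \<in> T x \<Longrightarrow> y' \<in> T y
      \<Longrightarrow> lam * dist x y \<le> dist x' y'"
proof -
  from assms obtain lam \<eta> where le: "lam > 1" "\<eta> > 0"
    and E: "\<forall>x\<in>X. \<forall>y\<in>X. dist x y \<le> \<eta> \<longrightarrow>
      (INF (x', y')\<in>T x \<times> T y. ereal (dist x' y')) \<ge> ereal (lam * dist x y)"
    unfolding expanding_on_def by blast
  have "lam * dist x y \<le> dist x' y'"
    if "x \<in> X" "y \<in> X" "dist x y \<le> \<eta>" "x' \<in> T x" "y' \<in> T y" for x y x' y'
  proof -
    have "ereal (lam * dist x y) \<le> (INF (x', y')\<in>T x \<times> T y. ereal (dist x' y'))"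
      using E that by blast
    also have "\<dots> \<le> (case (x', y') of (x', y') \<Rightarrow> ereal (dist x' y'))"
      by (rule INF_lower) (use that in blast)
    finally show ?thesis by simp
  qed
  with le that show thesis by blast
qed

text \<open>
  The complement of a small ball around a point outside \<open>T x\<close> is a neighbourhood of \<open>T x\<close>, so upper
  semi-continuity keeps the values of \<open>T\<close> near \<open>x\<close> out of that ball.
\<close>

lemma usc_on_graph_limit:
  assumes "multimap_on X T" "\<forall>x\<in>X. closed (T x)" "usc_on X T"
    and a: "a \<longlonglongrightarrow> x" "\<And>k. a k \<in> X" "x \<in> X"
    and b: "b \<longlonglongrightarrow> y" "\<And>k. b k \<in> T (a k)"
  shows "(y :: 'a :: metric_space) \<in> T x"
proof (rule ccontr)
  assume "y \<notin> T x"
  with assms(2) a(3) have "open (- T x)" "y \<in> - T x" by auto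
  then obtain r where r: "r > 0" "cball y r \<subseteq> - T x"
    by (meson open_contains_cball)
  define V where "V = X \<inter> (- cball y r)"
  have "openin (top_of_set X) V" unfolding V_def by (intro openin_open_Int) auto
  moreover have "T x \<subseteq> V" using assms(1) a(3) r unfolding V_def multimap_on_def by blast
  ultimately obtain U where U: "openin (top_of_set X) U" "x \<in> U" "\<forall>u\<in>U. T u \<subseteq> V"
    using assms(3) a(3) unfolding usc_on_def by meson
  from U(1) obtain W where W: "open W" "U = X \<inter> W" by (auto simp: openin_open)
  have "\<forall>\<^sub>F k in sequentially. a k \<in> W"
    using a(1) W U(2) by (auto dest: topological_tendstoD)
  moreover have "\<forall>\<^sub>F k in sequentially. dist (b k) y < r"
    using b(1) r(1) by (auto dest: tendstoD)
  ultimately have "\<forall>\<^sub>F k in sequentially. False"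
  proof eventually_elim
    case (elim k)
    then have "b k \<in> V" using U(3) W(2) a(2) b(2) by blast
    with elim show False unfolding V_def by (auto simp: dist_commute)
  qed
  then show False by simp
qed

lemma compact_graph_on:
  assumes "compact (X :: 'a :: metric_space set)"
    and "multimap_on X T" "\<forall>x\<in>X. closed (T x)" "usc_on X T"
  shows "compact (graph_on X T)"
proof -
  have "closed (graph_on X T)"
    unfolding closed_sequential_limits
  proof (intro allI impI, elim conjE)
    fix s l assume s: "\<forall>k. s k \<in> graph_on X T" and l: "s \<longlonglongrightarrow> l"
    have "closed X" using assms(1) by (rule compact_imp_closed)
    have f: "(\<lambda>k. fst (s k)) \<longlonglongrightarrow> fst l" and g: "(\<lambda>k. snd (s k)) \<longlonglongrightarrow> snd l"
      using l by (auto intro: tendsto_intros)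
    have m: "fst (s k) \<in> X" "snd (s k) \<in> X" "snd (s k) \<in> T (fst (s k))" for k
      using s[rule_format, of k] by (auto simp: graph_on_def)
    have "fst l \<in> X" "snd l \<in> X"
      using closed_sequentially[OF \<open>closed X\<close> _ f] closed_sequentially[OF \<open>closed X\<close> _ g] m by auto
    moreover have "snd l \<in> T (fst l)"
      by (rule usc_on_graph_limit[OF assms(2-4) f _ _ g]) (use m \<open>fst l \<in> X\<close> in auto)
    ultimately show "l \<in> graph_on X T" by (auto simp: graph_on_def)
  qed
  moreover have "graph_on X T \<subseteq> X \<times> X" by (auto simp: graph_on_def)
  ultimately show ?thesis
    using compact_Times[OF assms(1) assms(1)] by (metis compact_Int_closed inf.absorb_iff2)
qed

definition contracting_inverse_on ::
    "'a::metric_space set \<Rightarrow> ('a \<Rightarrow> 'a set) \<Rightarrow> real \<Rightarrow> real \<Rightarrow> bool" where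
  "contracting_inverse_on X T lam \<delta> \<longleftrightarrow>
    (\<forall>(x, x')\<in>graph_on X T. \<forall>y'\<in>X. dist x' y' < \<delta> \<longrightarrow>
      (\<exists>y. (y, y') \<in> graph_on X T \<and> lam * dist x y \<le> dist x' y'))"

text \<open>
  At a single edge \<open>(x, x')\<close>, openness maps the ball of radius \<open>\<eta> / 2\<close> around \<open>x\<close> onto a
  neighbourhood of \<open>x'\<close>, and expansion turns the existence of a preimage in that ball into the
  contraction estimate. Compactness of the graph makes the radius uniform: a sequence of
  counterexamples with shrinking radius would accumulate at an edge.
\<close>

lemma contracting_inverse_onI_expanding:
  assumes "compact (X :: 'a :: metric_space set)"
    and "multimap_on X T" "\<forall>x\<in>X. closed (T x)" "usc_on X T"
    and "open_multimap_on X T" "expanding_on X T"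
  obtains lam \<delta> where "lam > 1" "\<delta> > 0" "contracting_inverse_on X T lam \<delta>"
proof -
  from expanding_onE[OF assms(6)] obtain lam \<eta> where le: "lam > 1" "\<eta> > 0"
    and E: "\<And>x y x' y'. x \<in> X \<Longrightarrow> y \<in> X \<Longrightarrow> dist x y \<le> \<eta> \<Longrightarrow> x' \<in> T x \<Longrightarrow> y' \<in> T y
      \<Longrightarrow> lam * dist x y \<le> dist x' y'" by metis
  have "\<exists>\<delta>>0. contracting_inverse_on X T lam \<delta>"
  proof (rule ccontr)
    assume "\<not> ?thesis"
    then have "\<forall>k. \<not> contracting_inverse_on X T lam (inverse (Suc k))"
      by (auto simp del: of_nat_Suc)
    then have "\<forall>k. \<exists>p y'. p \<in> graph_on X T \<and> y' \<in> X \<and> dist (snd p) y' < inverse (Suc k) \<and>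
        (\<forall>y. (y, y') \<in> graph_on X T \<longrightarrow> \<not> lam * dist (fst p) y \<le> dist (snd p) y')"
      unfolding contracting_inverse_on_def by fastforce
    then obtain p b where p: "\<And>k. p k \<in> graph_on X T" and b: "\<And>k. b k \<in> X"
      and d: "\<And>k. dist (snd (p k)) (b k) < inverse (Suc k)"
      and no: "\<And>k y. (y, b k) \<in> graph_on X T \<Longrightarrow> \<not> lam * dist (fst (p k)) y \<le> dist (snd (p k)) (b k)"
      by metis
    from compact_graph_on[OF assms(1-4)] p obtain l s where l: "l \<in> graph_on X T"
      and s: "strict_mono s" "(p \<circ> s) \<longlonglongrightarrow> l"
      unfolding compact_def by meson
    obtain x x' where [simp]: "l = (x, x')" by (cases l)
    have x: "x \<in> X" "x' \<in> X" "x' \<in> T x" using l by (auto simp: graph_on_def)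
    define A where "A = X \<inter> ball x (\<eta> / 2)"
    have "openin (top_of_set X) A" unfolding A_def by (intro openin_open_Int) auto
    then have "openin (top_of_set X) (\<Union>x\<in>A. T x)"
      using assms(5) by (auto simp: open_multimap_on_def)
    moreover have "x' \<in> (\<Union>x\<in>A. T x)" using x le by (auto simp: A_def)
    ultimately obtain W where W: "open W" "(\<Union>x\<in>A. T x) = X \<inter> W" "x' \<in> W"
      by (auto simp: openin_open)
    have c1: "(\<lambda>k. fst (p (s k))) \<longlonglongrightarrow> x" and c2: "(\<lambda>k. snd (p (s k))) \<longlonglongrightarrow> x'"
      using tendsto_fst[OF s(2)] tendsto_snd[OF s(2)] by (auto simp: o_def)
    have i0: "(\<lambda>k. inverse (real (Suc (s k)))) \<longlonglongrightarrow> 0"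
      using LIMSEQ_subseq_LIMSEQ[OF LIMSEQ_inverse_real_of_nat s(1)] by (simp add: o_def)
    have "(\<lambda>k. dist (snd (p (s k))) (b (s k))) \<longlonglongrightarrow> 0"
      by (rule tendsto_sandwich[OF _ _ tendsto_const i0])
        (use d in \<open>auto intro!: always_eventually less_imp_le simp del: of_nat_Suc\<close>)
    from tendsto_add[OF this iffD1[OF tendsto_dist_iff c2]]
    have sum0: "(\<lambda>k. dist (snd (p (s k))) (b (s k)) + dist (snd (p (s k))) x') \<longlonglongrightarrow> 0" by simp
    have "(\<lambda>k. dist (b (s k)) x') \<longlonglongrightarrow> 0"
      by (rule tendsto_sandwich[OF _ _ tendsto_const sum0])
        (auto intro!: always_eventually dist_triangle3)
    then have "(\<lambda>k. b (s k)) \<longlonglongrightarrow> x'" by (subst tendsto_dist_iff)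
    then have "\<forall>\<^sub>F k in sequentially. b (s k) \<in> W"
      using W by (auto dest: topological_tendstoD)
    moreover have "\<forall>\<^sub>F k in sequentially. dist (fst (p (s k))) x < \<eta> / 2"
      using tendstoD[OF c1, of "\<eta> / 2"] le by simp
    ultimately have "\<forall>\<^sub>F k in sequentially. False"
    proof eventually_elim
      case (elim k)
      then have "b (s k) \<in> (\<Union>x\<in>A. T x)" using W b by blast
      then obtain y where y: "y \<in> A" "b (s k) \<in> T y" by blast
      \<comment> \<open>both first coordinates are within \<open>\<eta> / 2\<close> of \<open>x\<close>, hence in the range of expansion\<close>
      have "dist (fst (p (s k))) y \<le> \<eta>"
        using y(1) elim(2) dist_triangle[of "fst (p (s k))" y x] by (auto simp: A_def)
      moreover have "fst (p (s k)) \<in> X" "snd (p (s k)) \<in> T (fst (p (s k)))"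
        using p[of "s k"] by (auto simp: graph_on_def)
      ultimately have "lam * dist (fst (p (s k))) y \<le> dist (snd (p (s k))) (b (s k))"
        using E y by (auto simp: A_def)
      moreover have "(y, b (s k)) \<in> graph_on X T" using y b by (auto simp: graph_on_def A_def)
      ultimately show False using no by blast
    qed
    then show False by simp
  qed
  with le that show thesis by blast
qed

section \<open>Shadowing and closing\<close>

definition orbit_segment :: "'a set \<Rightarrow> ('a \<Rightarrow> 'a set) \<Rightarrow> nat \<Rightarrow> (nat \<Rightarrow> 'a) \<Rightarrow> bool" where
  "orbit_segment X T n x \<longleftrightarrow> (\<forall>i\<le>n. x i \<in> X) \<and> (\<forall>i<n. (x i, x (Suc i)) \<in> graph_on X T)"

text \<open>
  The end point is moved to \<open>z\<close> and the earlier points follow by inverse branches. The branches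
  never leave their balls of radius \<open>\<delta>\<close>, because the distances only decrease backwards in time.
\<close>

lemma orbit_segment_shadow:
  assumes "contracting_inverse_on X T lam \<delta>" "lam > 1"
    and "orbit_segment X T n x" "z \<in> X" "dist (x n) z < \<delta>"
  shows "\<exists>y. orbit_segment X T n y \<and> y n = z \<and>
    (\<forall>i\<le>n. lam ^ (n - i) * dist (x i) (y i) \<le> dist (x n) z)"
  using assms(3-)
proof (induction n arbitrary: z)
  case 0
  then show ?case by (intro exI[of _ "\<lambda>_. z"]) (auto simp: orbit_segment_def)
next
  case (Suc n)
  have "(x n, x (Suc n)) \<in> graph_on X T" using Suc.prems by (auto simp: orbit_segment_def)
  with assms(1) Suc.prems obtain w where w: "(w, z) \<in> graph_on X T"
    and d: "lam * dist (x n) w \<le> dist (x (Suc n)) z"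
    unfolding contracting_inverse_on_def by blast
  have "dist (x n) w \<le> lam * dist (x n) w"
    using assms(2) mult_right_mono[of 1 lam "dist (x n) w"] by simp
  then have "dist (x n) w < \<delta>" using d Suc.prems by simp
  moreover have "orbit_segment X T n x" using Suc.prems by (auto simp: orbit_segment_def)
  moreover have "w \<in> X" using w by (auto simp: graph_on_def)
  ultimately obtain y where y: "orbit_segment X T n y" "y n = w"
    and c: "\<forall>i\<le>n. lam ^ (n - i) * dist (x i) (y i) \<le> dist (x n) w"
    using Suc.IH by blast
  define y' where "y' = y(Suc n := z)"
  have "orbit_segment X T (Suc n) y'"
    using y w Suc.prems(2) by (auto simp: orbit_segment_def y'_def less_Suc_eq le_Suc_eq)
  moreover have "lam ^ (Suc n - i) * dist (x i) (y' i) \<le> dist (x (Suc n)) z"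
    if "i \<le> Suc n" for i
  proof (cases "i = Suc n")
    case False
    with that have i: "i \<le> n" by simp
    have "lam ^ (Suc n - i) * dist (x i) (y' i) = lam * (lam ^ (n - i) * dist (x i) (y i))"
      using i by (simp add: y'_def Suc_diff_le)
    also have "\<dots> \<le> lam * dist (x n) w"
      using c i assms(2) by (intro mult_left_mono) auto
    finally show ?thesis using d by simp
  qed (simp add: y'_def)
  moreover have "y' (Suc n) = z" by (simp add: y'_def)
  ultimately show ?case by blast
qed

lemma geometric_steps_converge:
  fixes z :: "nat \<Rightarrow> 'a :: metric_space"
  assumes "\<And>k. dist (z k) (z (Suc k)) \<le> c * r ^ k" "0 \<le> r" "r < 1" "range z \<subseteq> X" "compact X"
  obtains l where "l \<in> X" "z \<longlonglongrightarrow> l" "dist (z 0) l \<le> c / (1 - r)"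
proof -
  have c: "c \<ge> 0" using order.trans[OF zero_le_dist assms(1)[of 0]] by simp
  have d: "dist (z k) (z (k + j)) \<le> c * r ^ k / (1 - r)" for k j
  proof -
    have "dist (z k) (z (k + j)) \<le> c * r ^ k * (\<Sum>i<j. r ^ i)"
    proof (induction j)
      case (Suc j)
      have "dist (z k) (z (k + Suc j)) \<le> dist (z k) (z (k + j)) + dist (z (k + j)) (z (Suc (k + j)))"
        using dist_triangle by simp
      also have "\<dots> \<le> c * r ^ k * (\<Sum>i<j. r ^ i) + c * r ^ (k + j)"
        using Suc assms(1) by (intro add_mono) auto
      finally show ?case by (simp add: algebra_simps power_add)
    qed simp
    also have "(\<Sum>i<j. r ^ i) \<le> 1 / (1 - r)"
      using assms(2,3) by (subst sum_gp_strict) (auto simp: divide_simps)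
    finally show ?thesis using c assms(2) by (simp add: mult_left_mono)
  qed
  have lim: "(\<lambda>k. c * r ^ k / (1 - r)) \<longlonglongrightarrow> 0"
    using tendsto_mult[OF tendsto_const[of "c / (1 - r)"] LIMSEQ_realpow_zero[OF assms(2,3)]]
    by simp
  have "Cauchy z"
  proof (rule metric_CauchyI)
    fix e :: real assume "e > 0"
    then have "\<forall>\<^sub>F k in sequentially. c * r ^ k / (1 - r) < e / 2"
      by (intro order_tendstoD(2)[OF lim]) simp
    then obtain M where M: "c * r ^ M / (1 - r) < e / 2"
      unfolding eventually_sequentially by blast
    have "dist (z M) (z m) < e / 2" if "m \<ge> M" for m
      using d[of M "m - M"] M that by (metis le_add_diff_inverse order.strict_trans1)
    then have "dist (z m) (z n) < e" if "m \<ge> M" "n \<ge> M" for m n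
      using that dist_triangle_half_l by (metis dist_commute)
    then show "\<exists>M. \<forall>m\<ge>M. \<forall>n\<ge>M. dist (z m) (z n) < e" by blast
  qed
  then obtain l where l: "l \<in> X" "z \<longlonglongrightarrow> l"
    using compact_imp_complete[OF assms(5)] assms(4) by (auto elim!: completeE)
  have "dist (z 0) l \<le> c / (1 - r)"
    using d[of 0] by (intro tendsto_upperbound[OF tendsto_dist[OF tendsto_const l(2)]]) auto
  with l that show thesis by blast
qed

text \<open>
  Anosov closing. The inverse branch along the whole segment moves points near the end to points
  near the beginning. Applied repeatedly, each time with the beginning of the last segment as the
  new end point, it gives segments \<open>z\<^sub>k\<close> with gap \<open>dist (z\<^sub>k n) (z\<^sub>k 0)\<close> decaying like
  \<open>lam\<close> to the power \<open>- n k\<close>. They converge, and since the graph is closed, to a closed orbit.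
  The factor \<open>lam / (lam - 1)\<close> is the sum of the geometric series with ratio \<open>1 / lam\<close>, which
  dominates the series of all corrections for every length \<open>n > 0\<close>.
\<close>

lemma orbit_segment_closing:
  assumes "compact X" "multimap_on X T" "\<forall>x\<in>X. closed (T x)" "usc_on X T"
    and ci: "contracting_inverse_on X T lam \<delta>" "lam > 1"
    and x: "orbit_segment X T n x" "n > 0" "dist (x n) (x 0) < \<delta>"
  obtains y where "orbit_segment X T n y" "y n = y 0"
    "\<And>i. i \<le> n \<Longrightarrow> lam ^ (n - i) * dist (x i) (y i) \<le> dist (x n) (x 0) * (lam / (lam - 1))"
proof -
  define D where "D = dist (x n) (x 0)"
  define r where "r = 1 / lam ^ n"
  have r: "0 \<le> r" "r < 1" "r \<le> 1 / lam"
    using ci(2) x(2) one_less_power[of lam n] self_le_power[of lam n]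
    by (auto simp: r_def divide_simps)
  have D: "0 \<le> D" "D < \<delta>" using x by (auto simp: D_def)
  let ?P = "\<lambda>k z. orbit_segment X T n z \<and> dist (z n) (z 0) \<le> D * r ^ k \<and> (k = 0 \<longrightarrow> z = x)"
  let ?Q = "\<lambda>k z w. w n = z 0 \<and> (\<forall>i\<le>n. lam ^ (n - i) * dist (z i) (w i) \<le> D * r ^ k)"
  have "\<exists>f. \<forall>k. ?P k (f k) \<and> ?Q k (f k) (f (Suc k))"
  proof (rule dependent_nat_choice)
    show "\<exists>z. ?P 0 z" using x by (auto simp: D_def)
    fix z k assume z: "?P k z"
    have "D * r ^ k \<le> D" using D r by (simp add: mult_left_le power_le_one)
    then have "dist (z n) (z 0) < \<delta>" using z D by simp
    moreover have "z 0 \<in> X" using z by (auto simp: orbit_segment_def)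
    ultimately obtain w where w: "orbit_segment X T n w" "w n = z 0"
      "\<forall>i\<le>n. lam ^ (n - i) * dist (z i) (w i) \<le> dist (z n) (z 0)"
      using orbit_segment_shadow[OF ci] z by blast
    have "lam ^ n * dist (z 0) (w 0) \<le> D * r ^ k" using w(3) z by force
    then have "dist (w n) (w 0) \<le> D * r ^ Suc k"
      using ci(2) w(2) by (simp add: r_def divide_simps mult_ac)
    with w z show "\<exists>w. ?P (Suc k) w \<and> ?Q k z w" by (intro exI[of _ w]) force
  qed
  then obtain z where z: "\<And>k. ?P k (z k)" "\<And>k. ?Q k (z k) (z (Suc k))" by blast
  have "\<exists>l. l \<in> X \<and> (\<lambda>k. z k i) \<longlonglongrightarrow> l \<and> lam ^ (n - i) * dist (x i) l \<le> D * (lam / (lam - 1))"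
    if i: "i \<le> n" for i
  proof -
    have "dist (z k i) (z (Suc k) i) \<le> D / lam ^ (n - i) * r ^ k" for k
      using z(2)[of k] i ci(2) by (auto simp: divide_simps mult.commute)
    moreover have "range (\<lambda>k. z k i) \<subseteq> X" using z(1) i by (auto simp: orbit_segment_def)
    ultimately obtain l where l: "l \<in> X" "(\<lambda>k. z k i) \<longlonglongrightarrow> l"
      "dist (z 0 i) l \<le> D / lam ^ (n - i) / (1 - r)"
      using geometric_steps_converge[of "\<lambda>k. z k i" "D / lam ^ (n - i)" r X] r assms(1) by metis
    have "z 0 = x" using z(1)[of 0] by simp
    have "lam ^ (n - i) * dist (x i) l \<le> lam ^ (n - i) * (D / lam ^ (n - i) / (1 - r))"
      using l(3) ci(2) \<open>z 0 = x\<close> by (intro mult_left_mono) auto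
    also have "\<dots> = D / (1 - r)" using ci(2) by simp
    finally have "lam ^ (n - i) * dist (x i) l \<le> D / (1 - r)" .
    also have "D / (1 - r) \<le> D / (1 - 1 / lam)"
      using r D ci(2) by (intro divide_left_mono) auto
    also have "\<dots> = D * (lam / (lam - 1))" using ci(2) by (simp add: field_simps)
    finally show ?thesis using l by blast
  qed
  then obtain y where y: "\<And>i. i \<le> n \<Longrightarrow> y i \<in> X" "\<And>i. i \<le> n \<Longrightarrow> (\<lambda>k. z k i) \<longlonglongrightarrow> y i"
    "\<And>i. i \<le> n \<Longrightarrow> lam ^ (n - i) * dist (x i) (y i) \<le> D * (lam / (lam - 1))" by metis
  have "y (Suc i) \<in> T (y i)" if "i < n" for i
    by (rule usc_on_graph_limit[OF assms(2-4) y(2)[of i] _ _ y(2)[of "Suc i"]])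
      (use that z(1) y(1) in \<open>auto simp: orbit_segment_def graph_on_def\<close>)
  then have "orbit_segment X T n y" using y(1) by (auto simp: orbit_segment_def graph_on_def)
  moreover have "y n = y 0"
  proof (rule LIMSEQ_unique)
    show "(\<lambda>k. z (Suc k) n) \<longlonglongrightarrow> y n" using y(2) by (subst filterlim_sequentially_Suc) auto
    show "(\<lambda>k. z (Suc k) n) \<longlonglongrightarrow> y 0" using y(2)[of 0] z(2) by simp
  qed
  ultimately show thesis using y(3) that by (simp add: D_def)
qed

section \<open>Birkhoff sums\<close>

text \<open>
  The bound does not depend on the length \<open>n\<close>, because the distances of the two segments, and so
  their \<open>\<alpha>\<close>-th powers, form a geometric series backwards in time.
\<close>

lemma birkhoff_sum_holder:
  assumes h: "\<And>a b. a \<in> X \<Longrightarrow> b \<in> X \<Longrightarrow> \<bar>f a - f b\<bar> \<le> K * dist a b powr \<alpha>"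
    and "K > 0" "0 < \<alpha>" "lam > 1" "D \<ge> 0"
    and "orbit_segment X T n x" "orbit_segment X T n y"
    and d: "\<And>i. i \<le> n \<Longrightarrow> lam ^ (n - i) * dist (x i) (y i) \<le> D"
  shows "\<bar>(\<Sum>i<n. f (x i)) - (\<Sum>i<n. f (y i))\<bar> \<le> K / (1 - lam powr - \<alpha>) * D powr \<alpha>"
proof -
  define t where "t = lam powr - \<alpha>"
  have t: "0 \<le> t" "t < 1" using assms(3,4) by (auto simp: t_def powr_less_one)
  have "\<bar>(\<Sum>i<n. f (x i)) - (\<Sum>i<n. f (y i))\<bar> \<le> (\<Sum>i<n. \<bar>f (x i) - f (y i)\<bar>)"
    using sum_abs[of "\<lambda>i. f (x i) - f (y i)" "{..<n}"] by (simp only: sum_subtractf)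
  also have "\<dots> \<le> (\<Sum>i<n. K * D powr \<alpha> * t ^ (n - Suc i))"
  proof (rule sum_mono)
    fix i assume "i \<in> {..<n}"
    then have i: "i < n" by simp
    have l: "lam ^ (n - i) > 0" using assms(4) by simp
    have "(lam ^ (n - i)) powr \<alpha> = lam powr (real (n - i) * \<alpha>)"
      using assms(4) powr_powr[of lam "real (n - i)" \<alpha>] by (simp add: powr_realpow)
    moreover have "t ^ (n - i) = lam powr - (real (n - i) * \<alpha>)"
      using assms(4) powr_power[of lam "- \<alpha>" "n - i"] by (simp add: t_def mult.commute)
    ultimately have shrink: "(D / lam ^ (n - i)) powr \<alpha> = D powr \<alpha> * t ^ (n - i)"
      using assms(4,5) l by (simp add: powr_divide powr_minus) (simp add: divide_inverse)
    have "\<bar>f (x i) - f (y i)\<bar> \<le> K * dist (x i) (y i) powr \<alpha>"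
      using i assms(6,7) by (intro h) (auto simp: orbit_segment_def)
    also have "\<dots> \<le> K * (D / lam ^ (n - i)) powr \<alpha>"
    proof -
      have "dist (x i) (y i) \<le> D / lam ^ (n - i)"
        using d[of i] i l by (simp add: pos_le_divide_eq mult.commute)
      then show ?thesis using assms(2,3) by (intro mult_left_mono powr_mono2) auto
    qed
    also have "\<dots> = K * D powr \<alpha> * t ^ (n - i)" by (simp add: shrink)
    also have "\<dots> \<le> K * D powr \<alpha> * t ^ (n - Suc i)"
      using t assms(2) by (intro mult_left_mono power_decreasing) auto
    finally show "\<bar>f (x i) - f (y i)\<bar> \<le> K * D powr \<alpha> * t ^ (n - Suc i)" .
  qed
  also have "\<dots> = K * D powr \<alpha> * (\<Sum>i<n. t ^ i)"
    by (simp only: sum_distrib_left sum.nat_diff_reindex[of "\<lambda>i. K * D powr \<alpha> * t ^ i"])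
  also have "\<dots> \<le> K * D powr \<alpha> * (1 / (1 - t))"
    using t assms(2) by (intro mult_left_mono) (auto simp: sum_gp_strict divide_simps)
  finally show ?thesis by (simp add: t_def)
qed

text \<open>
  The map \<open>c\<close> colours the indices, and \<open>F\<close> contains the colours that occur. Jumping from the first
  index to the last index of the same colour costs at most \<open>C\<close>, the next step costs at most \<open>M\<close>, and
  this colour does not occur again. So every colour is paid for once, however long the interval is.
\<close>

lemma sum_bounded_by_recurrence:
  fixes g :: "nat \<Rightarrow> real" and C M :: real
  assumes "finite F" "C \<ge> 0" "M \<ge> 0"
    and rec: "\<And>i j. i < j \<Longrightarrow> j < n \<Longrightarrow> c i = c j \<Longrightarrow> sum g {i..<j} \<le> C"
    and g: "\<And>i. i < n \<Longrightarrow> g i \<le> M"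
    and "c ` {m..<n} \<subseteq> F"
  shows "sum g {m..<n} \<le> card F * (C + M)"
  using assms(1,6)
proof (induction F arbitrary: m rule: finite_psubset_induct)
  case (psubset F)
  show ?case
  proof (cases "m < n")
    case False
    then show ?thesis using assms(2,3) by simp
  next
    case True
    let ?J = "{j \<in> {m..<n}. c j = c m}"
    define j where "j = Max ?J"
    have "j \<in> ?J" unfolding j_def by (rule Max_in) (use True in auto)
    then have j: "m \<le> j" "j < n" "c j = c m" by auto
    have mx: "i \<le> j" if "i \<in> ?J" for i unfolding j_def by (rule Max_ge) (use that in auto)
    have cm: "c m \<in> F" using psubset.prems True by auto
    have rest: "c ` {Suc j..<n} \<subseteq> F - {c m}"
    proof
      fix a assume "a \<in> c ` {Suc j..<n}"
      then obtain i where i: "a = c i" "Suc j \<le> i" "i < n" by auto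
      then have "a \<in> F" using psubset.prems j(1) by force
      moreover have "a \<noteq> c m" using mx[of i] i j by auto
      ultimately show "a \<in> F - {c m}" by blast
    qed
    have "F - {c m} \<subset> F" using cm by blast
    then have "sum g {Suc j..<n} \<le> card (F - {c m}) * (C + M)"
      using rest by (rule psubset.IH)
    moreover have "sum g {m..<j} \<le> C"
    proof (cases "m = j")
      case True
      then show ?thesis using assms(2) by simp
    next
      case False
      with j(1) have "m < j" by simp
      then show ?thesis using j(2) j(3)[symmetric] by (rule rec)
    qed
    moreover have "g j \<le> M" using g j by blast
    moreover have "sum g {m..<n} = sum g {m..<j} + (g j + sum g {Suc j..<n})"
      using sum.atLeastLessThan_concat[OF j(1) less_imp_le[OF j(2)], of g]
        sum.atLeast_Suc_lessThan[OF j(2), of g] by linarith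
    ultimately have "sum g {m..<n} \<le> real (Suc (card (F - {c m}))) * (C + M)"
      by (simp add: algebra_simps)
    moreover have "Suc (card (F - {c m})) = card F"
      using cm psubset.hyps by (intro card_Suc_Diff1)
    ultimately show ?thesis by (simp only:)
  qed
qed

section \<open>Invariant measures on periodic orbits\<close>

lemma card_periodic_shift:
  assumes "n > 0" "\<And>i. i < n \<Longrightarrow> P (Suc i) \<Longrightarrow> Q i" "P n = P 0"
  shows "card {i. i < n \<and> P i} \<le> card {i. i < n \<and> Q i}"
proof (rule card_inj_on_le)
  let ?h = "\<lambda>i. if i = 0 then n - 1 else i - 1"
  show "inj_on ?h {i. i < n \<and> P i}" by (auto simp: inj_on_def split: if_splits)
  show "?h ` {i. i < n \<and> P i} \<subseteq> {i. i < n \<and> Q i}"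
  proof
    fix j assume "j \<in> ?h ` {i. i < n \<and> P i}"
    then obtain i where i: "i < n" "P i" "j = ?h i" by auto
    then have "j < n \<and> P (Suc j)" using assms(1,3) by auto
    then show "j \<in> {i. i < n \<and> Q i}" using assms(2) by blast
  qed
qed simp

text \<open>
  The measure is the image of the uniform distribution on the indices, so that points visited several
  times in a period get the right multiplicity. It is invariant because the cyclic predecessor of
  an index with \<open>y i \<in> A\<close> is an index whose point lies in the preimage of \<open>A\<close>. That preimage
  is measurable for the completion, because the measure lives on a finite set.
\<close>

lemma periodic_average_le_max_ergodic_average:
  fixes X :: "'a::metric_space set"
  assumes y: "orbit_segment X T n y" "n > 0" "y n = y 0"
    and f: "f \<in> borel_measurable (restrict_space borel X)"
  shows "ereal ((\<Sum>i<n. f (y i)) / n) \<le> max_ergodic_average X T f"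
proof -
  let ?p = "measure_pmf (pmf_of_set {..<n})"
  let ?B = "restrict_space borel X"
  \<comment> \<open>indices at or beyond the period carry no mass, but must still be sent into \<open>X\<close>\<close>
  define h where "h = (\<lambda>i. if i < n then y i else y 0)"
  define \<mu> where "\<mu> = distr ?p ?B h"
  have ne: "{..<n} \<noteq> {}" using y(2) by auto
  have hX: "h i \<in> X" for i using y by (auto simp: h_def orbit_segment_def)
  have h: "h \<in> measurable ?p ?B"
    using hX by (auto simp: measurable_def space_restrict_space)
  have sets: "sets \<mu> = sets ?B" by (simp add: \<mu>_def)
  have P: "prob_space \<mu>" unfolding \<mu>_def
    by (intro prob_space.prob_space_distr h measure_pmf.prob_space_axioms)
  have em: "emeasure \<mu> A = ennreal (card {i. i < n \<and> y i \<in> A} / n)" if "A \<in> sets \<mu>" for A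
  proof -
    have "emeasure \<mu> A = emeasure ?p (h -` A)"
      using that h by (simp add: \<mu>_def emeasure_distr)
    also have "\<dots> = ennreal (card ({..<n} \<inter> h -` A) / n)"
      using ne by (simp add: measure_pmf.emeasure_eq_measure measure_pmf_of_set)
    also have "{..<n} \<inter> h -` A = {i. i < n \<and> y i \<in> A}" by (auto simp: h_def)
    finally show ?thesis .
  qed
  have inv: "emeasure \<mu> A \<le> emeasure (completion \<mu>) (preimage_on X T A)" if A: "A \<in> sets \<mu>" for A
  proof -
    define F where "F = y ` {..<n}"
    have FX: "F \<subseteq> X" using y by (auto simp: F_def orbit_segment_def)
    have fin: "G \<in> sets \<mu>" if "G \<subseteq> F" for G
    proof -
      have "finite G" using that by (rule finite_subset) (simp add: F_def)
      then show ?thesis unfolding sets sets_restrict_space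
        using that FX by (intro image_eqI[of _ _ G]) (auto intro: borel_closed finite_imp_closed)
    qed
    let ?G = "preimage_on X T A \<inter> F"
    have "emeasure \<mu> (space \<mu> - F) = 0"
    proof -
      have "space \<mu> - F \<in> sets \<mu>" using fin[of F] by auto
      moreover have "{i. i < n \<and> y i \<in> space \<mu> - F} = {}" by (auto simp: F_def)
      ultimately show ?thesis using em[of "space \<mu> - F"] by (simp only:) simp
    qed
    then have null: "space \<mu> - F \<in> null_sets \<mu>" using fin[of F] by (auto intro: null_setsI)
    have "preimage_on X T A \<subseteq> space \<mu>"
      by (auto simp: preimage_on_def \<mu>_def space_restrict_space)
    then have split: "preimage_on X T A = ?G \<union> (preimage_on X T A - F)"
      "preimage_on X T A - F \<subseteq> space \<mu> - F" by auto
    have meas: "preimage_on X T A \<in> sets (completion \<mu>)"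
      unfolding sets_completion by (rule completionI[OF split null fin]) auto
    have "card {i. i < n \<and> y i \<in> A} \<le> card {i. i < n \<and> y i \<in> ?G}"
    proof (rule card_periodic_shift)
      fix i assume "i < n" "y (Suc i) \<in> A"
      then show "y i \<in> ?G"
        using y(1) by (auto simp: preimage_on_def F_def orbit_segment_def graph_on_def)
    qed (use y in auto)
    then have "emeasure \<mu> A \<le> emeasure \<mu> ?G"
      using A fin[of ?G] by (simp add: em divide_right_mono ennreal_leI)
    also have "\<dots> = emeasure (completion \<mu>) ?G" using fin[of ?G] by simp
    also have "\<dots> \<le> emeasure (completion \<mu>) (preimage_on X T A)"
      using meas by (intro emeasure_mono) auto
    finally show ?thesis .
  qed
  have "integral\<^sup>L \<mu> f = (\<integral>i. f (h i) \<partial>?p)"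
    unfolding \<mu>_def using h f by (rule integral_distr)
  also have "\<dots> = (\<Sum>i<n. f (h i)) / n"
    using ne by (subst integral_pmf_of_set) auto
  also have "(\<Sum>i<n. f (h i)) = (\<Sum>i<n. f (y i))" by (rule sum.cong) (auto simp: h_def)
  finally have "ereal ((\<Sum>i<n. f (y i)) / n) = ereal (integral\<^sup>L \<mu> f)" by simp
  also have "\<dots> \<le> max_ergodic_average X T f"
    unfolding max_ergodic_average_def
    by (rule SUP_upper) (use P sets inv in \<open>auto simp: invariant_measure_on_def\<close>)
  finally show ?thesis .
qed

section \<open>The sub-action\<close>

text \<open>
  The case \<open>n = 0\<close> contributes the empty sum, so \<open>0\<close> belongs to this set for every \<open>y \<in> X\<close>, even
  for points without any preimage.
\<close>

definition backward_sums ::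
    "'a set \<Rightarrow> ('a \<Rightarrow> 'a set) \<Rightarrow> ('a \<Rightarrow> real) \<Rightarrow> 'a \<Rightarrow> real set" where
  "backward_sums X T g y = {\<Sum>i<n. g (x i) |n x. orbit_segment X T n x \<and> x n = y}"

lemma holder_on_imp_continuous_on:
  assumes "holder_on \<alpha> X f" "0 < \<alpha>"
  shows "continuous_on X f"
proof -
  from assms obtain K where K: "K > 0"
    "\<And>z z'. z \<in> X \<Longrightarrow> z' \<in> X \<Longrightarrow> \<bar>f z - f z'\<bar> \<le> K * dist z z' powr \<alpha>"
    unfolding holder_on_def by blast
  show ?thesis unfolding continuous_on_def
  proof
    fix x assume x: "x \<in> X"
    have "((\<lambda>z. dist z x) \<longlongrightarrow> 0) (at x within X)"
      by (intro tendsto_eq_intros) auto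
    then have "((\<lambda>z. dist z x powr \<alpha>) \<longlongrightarrow> 0) (at x within X)"
      by (rule tendsto_zero_powrI) (use assms(2) in auto)
    then have "((\<lambda>z. K * dist z x powr \<alpha>) \<longlongrightarrow> 0) (at x within X)"
      by (rule tendsto_mult_right_zero)
    then have "((\<lambda>z. f z - f x) \<longlongrightarrow> 0) (at x within X)"
      by (rule Lim_null_comparison[rotated]) (use K x in \<open>auto simp: eventually_at_filter\<close>)
    then show "(f \<longlongrightarrow> f x) (at x within X)" by (simp add: LIM_zero_iff)
  qed
qed

text \<open>
  The points of a segment are coloured by the centre of a ball of radius \<open>\<delta> / 2\<close> that contains them.
  Two points of the same colour bound a piece that can be closed up to a periodic orbit, along which
  the sum of \<open>f - b\<close> is at most \<open>0\<close>.
\<close>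

lemma backward_sums_bounded:
  fixes X :: "'a::metric_space set"
  assumes X: "compact X" "multimap_on X T" "\<forall>x\<in>X. closed (T x)" "usc_on X T"
    and ci: "contracting_inverse_on X T lam \<delta>" "lam > 1" "\<delta> > 0"
    and f: "holder_on \<alpha> X f" "0 < \<alpha>"
    and b: "max_ergodic_average X T f \<le> ereal b"
  obtains B where "B \<ge> 0" "\<And>y s. s \<in> backward_sums X T (\<lambda>x. f x - b) y \<Longrightarrow> s \<le> B"
proof -
  from f(1) obtain K where K: "K > 0"
    "\<And>z z'. z \<in> X \<Longrightarrow> z' \<in> X \<Longrightarrow> \<bar>f z - f z'\<bar> \<le> K * dist z z' powr \<alpha>"
    unfolding holder_on_def by blast
  have cont: "continuous_on X f" using f by (rule holder_on_imp_continuous_on)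
  then have meas: "f \<in> borel_measurable (restrict_space borel X)"
    by (rule borel_measurable_continuous_on_restrict)
  \<comment> \<open>the error of replacing a piece whose ends are less than \<open>\<delta>\<close> apart by its periodic shadow\<close>
  define C where "C = K / (1 - lam powr - \<alpha>) * (\<delta> * (lam / (lam - 1))) powr \<alpha>"
  have "lam powr - \<alpha> < 1" using ci f by (simp add: powr_less_one)
  then have C: "C \<ge> 0" using K by (simp add: C_def)
  have "bounded (f ` X)"
    by (intro compact_imp_bounded compact_continuous_image cont X)
  then obtain M0 where M0: "\<And>x. x \<in> X \<Longrightarrow> \<bar>f x\<bar> \<le> M0" by (auto simp: bounded_iff)
  define M where "M = max 0 (M0 - b)"
  have "\<forall>e>0. \<exists>k. finite k \<and> X \<subseteq> (\<Union>a\<in>k. ball a e)"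
    using X(1) by (simp add: compact_eq_totally_bounded)
  then obtain k where k: "finite k" "X \<subseteq> (\<Union>a\<in>k. ball a (\<delta> / 2))"
    using half_gt_zero[OF ci(3)] by meson
  have "\<exists>c. \<forall>x\<in>X. c x \<in> k \<and> dist (c x) x < \<delta> / 2"
  proof (intro bchoice ballI)
    fix x assume "x \<in> X"
    with k(2) obtain a where "a \<in> k" "x \<in> ball a (\<delta> / 2)" by blast
    then show "\<exists>a. a \<in> k \<and> dist a x < \<delta> / 2" unfolding mem_ball by blast
  qed
  then obtain c where c: "\<And>x. x \<in> X \<Longrightarrow> c x \<in> k" "\<And>x. x \<in> X \<Longrightarrow> dist (c x) x < \<delta> / 2"
    by blast
  have bound: "(\<Sum>i<n. f (x i) - b) \<le> card k * (C + M)" if x: "orbit_segment X T n x" for n x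
  proof -
    have xX: "x i \<in> X" if "i \<le> n" for i using x that by (auto simp: orbit_segment_def)
    have "(\<Sum>i\<in>{i..<j}. f (x i) - b) \<le> C" if ij: "i < j" "j < n" "c (x i) = c (x j)" for i j
    proof -
      define z where "z = (\<lambda>m. x (i + m))"
      define p where "p = j - i"
      have p: "p > 0" using ij by (simp add: p_def)
      have z: "orbit_segment X T p z"
        using x ij by (auto simp: orbit_segment_def z_def p_def)
      have ends: "z p = x j" "z 0 = x i" using ij by (auto simp: z_def p_def)
      have close: "dist (z p) (z 0) < \<delta>"
        using c(2)[of "x i"] c(2)[of "x j"] xX[of i] xX[of j] ij
          dist_triangle3[of "x j" "x i" "c (x i)"] by (simp add: ends)
      obtain y where y: "orbit_segment X T p y" "y p = y 0"
        "\<And>i. i \<le> p \<Longrightarrow> lam ^ (p - i) * dist (z i) (y i) \<le> dist (z p) (z 0) * (lam / (lam - 1))"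
        using orbit_segment_closing[OF X ci(1,2) z p close] by blast
      have "dist (z p) (z 0) * (lam / (lam - 1)) \<le> \<delta> * (lam / (lam - 1))"
        using close ci by (intro mult_right_mono) auto
      then have "lam ^ (p - i) * dist (z i) (y i) \<le> \<delta> * (lam / (lam - 1))" if "i \<le> p" for i
        using y(3)[OF that] by simp
      then have "\<bar>(\<Sum>i<p. f (z i)) - (\<Sum>i<p. f (y i))\<bar> \<le> C"
        unfolding C_def using ci
        by (intro birkhoff_sum_holder[OF K(2) K(1) f(2) ci(2) _ z y(1)]) auto
      moreover have "(\<Sum>i<p. f (y i)) \<le> p * b"
      proof -
        have "ereal ((\<Sum>i<p. f (y i)) / p) \<le> ereal b"
          using periodic_average_le_max_ergodic_average[OF y(1) p y(2) meas] b by (rule order.trans)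
        then show ?thesis using p by (simp add: field_simps)
      qed
      moreover have "(\<Sum>i\<in>{i..<j}. f (x i) - b) = (\<Sum>i<p. f (z i) - b)"
        using sum.shift_bounds_nat_ivl[of "\<lambda>i. f (x i) - b" 0 i p] ij
        by (simp add: z_def p_def atLeast0LessThan add.commute)
      ultimately show ?thesis by (simp add: sum_subtractf)
    qed
    moreover have "f (x i) - b \<le> M" if "i < n" for i
      using M0[of "x i"] xX[of i] that by (simp add: M_def)
    moreover have "(\<lambda>i. c (x i)) ` {0..<n} \<subseteq> k" using c(1) xX by auto
    ultimately have "(\<Sum>i\<in>{0..<n}. f (x i) - b) \<le> card k * (C + M)"
      using k(1) C by (intro sum_bounded_by_recurrence[where c = "\<lambda>i. c (x i)"]) (auto simp: M_def)
    then show ?thesis by (simp add: atLeast0LessThan)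
  qed
  show thesis
  proof (rule that)
    show "0 \<le> card k * (C + M)" using C by (simp add: M_def)
    show "s \<le> card k * (C + M)" if "s \<in> backward_sums X T (\<lambda>x. f x - b) y" for y s
      using that bound by (auto simp: backward_sums_def)
  qed
qed

theorem theorem6p3:
  fixes X :: "'a::metric_space set"
    and T :: "'a \<Rightarrow> 'a set"
    and \<alpha> :: real
    and f :: "'a \<Rightarrow> real"
  assumes "compact X"
    and "multimap_on X T"
    and "\<forall>x\<in>X. closed (T x)"
    and "usc_on X T"
    and "open_multimap_on X T"
    and "expanding_on X T"
    and "0 < \<alpha>" and "\<alpha> \<le> 1"
    and "holder_on \<alpha> X f"
    and "max_ergodic_average X T f \<noteq> -\<infinity> \<or> graph_on X T = {}"
  shows "\<exists>v :: 'a \<Rightarrow> real. holder_on \<alpha> X v \<and>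
    (\<forall>(x, y)\<in>graph_on X T. ereal (f x + v x - v y) \<le> max_ergodic_average X T f)"
proof (cases "graph_on X T = {} \<or> max_ergodic_average X T f = \<infinity>")
  case True
  have "holder_on \<alpha> X (\<lambda>_. 0)" by (auto simp: holder_on_def intro!: exI[of _ 1])
  with True show ?thesis by (intro exI[of _ "\<lambda>_. 0"]) auto
next
  case False
  with assms(10) obtain b where b: "max_ergodic_average X T f = ereal b"
    by (cases "max_ergodic_average X T f") auto
  from contracting_inverse_onI_expanding[OF assms(1-6)] obtain lam \<delta>
    where ci: "lam > 1" "\<delta> > 0" "contracting_inverse_on X T lam \<delta>" by metis
  define S where "S = backward_sums X T (\<lambda>x. f x - b)"
  obtain B where B: "B \<ge> 0" "\<And>y s. s \<in> S y \<Longrightarrow> s \<le> B"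
    unfolding S_def
    using backward_sums_bounded[OF assms(1-4) ci(3,1,2) assms(9,7) eq_refl[OF b]] by metis
  define v where "v = (\<lambda>y. Sup (S y))"
  have bdd: "bdd_above (S y)" for y using B(2) by (auto simp: bdd_above_def)
  have zero: "0 \<in> S y" if "y \<in> X" for y
    unfolding S_def backward_sums_def mem_Collect_eq
    by (rule exI[of _ 0], rule exI[of _ "\<lambda>_. y"]) (use that in \<open>simp add: orbit_segment_def\<close>)
  have v0: "0 \<le> v y" if "y \<in> X" for y
    unfolding v_def using zero[OF that] bdd by (rule cSup_upper)
  have vB: "v y \<le> B" if "y \<in> X" for y
    unfolding v_def using zero[OF that] B(2) by (intro cSup_least) blast+
  have sub: "f x + v x - v y \<le> b" if xy: "(x, y) \<in> graph_on X T" for x y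
  proof -
    have xX: "x \<in> X" "y \<in> X" using xy by (auto simp: graph_on_def)
    have "v x \<le> v y - (f x - b)"
      unfolding v_def
    proof (rule cSup_least)
      show "S x \<noteq> {}" using zero xX by blast
      fix s assume "s \<in> S x"
      then obtain n z where z: "orbit_segment X T n z" "z n = x" "s = (\<Sum>i<n. f (z i) - b)"
        by (auto simp: S_def backward_sums_def)
      let ?z = "z(Suc n := y)"
      have "orbit_segment X T (Suc n) ?z"
        using z xy xX by (auto simp: orbit_segment_def less_Suc_eq le_Suc_eq)
      moreover have "(\<Sum>i<Suc n. f (?z i) - b) = s + (f x - b)" using z by simp
      moreover have "?z (Suc n) = y" by simp
      ultimately have "s + (f x - b) \<in> S y"
        unfolding S_def backward_sums_def mem_Collect_eq by metis
      then have "s + (f x - b) \<le> Sup (S y)" using bdd by (rule cSup_upper)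
      then show "s \<le> Sup (S y) - (f x - b)" by simp
    qed
    then show ?thesis by simp
  qed
  from assms(9) obtain K where K: "K > 0"
    "\<And>z z'. z \<in> X \<Longrightarrow> z' \<in> X \<Longrightarrow> \<bar>f z - f z'\<bar> \<le> K * dist z z' powr \<alpha>"
    unfolding holder_on_def by blast
  define C where "C = K / (1 - lam powr - \<alpha>)"
  have "lam powr - \<alpha> < 1" using ci assms(7) by (simp add: powr_less_one)
  then have C: "C > 0" using K by (simp add: C_def)
  \<comment> \<open>a segment that ends in \<open>y\<close> is shadowed by one that ends in \<open>y'\<close>, with almost the same sum\<close>
  have near: "v y \<le> v y' + C * dist y y' powr \<alpha>"
    if y: "y \<in> X" "y' \<in> X" "dist y y' < \<delta>" for y y'
    unfolding v_def
  proof (rule cSup_least)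
    show "S y \<noteq> {}" using zero y by blast
    fix s assume "s \<in> S y"
    then obtain n z where z: "orbit_segment X T n z" "z n = y" "s = (\<Sum>i<n. f (z i) - b)"
      by (auto simp: S_def backward_sums_def)
    obtain w where w: "orbit_segment X T n w" "w n = y'"
      "\<And>i. i \<le> n \<Longrightarrow> lam ^ (n - i) * dist (z i) (w i) \<le> dist y y'"
      using orbit_segment_shadow[OF ci(3,1) z(1) y(2)] z(2) y(3) by auto
    have "\<bar>(\<Sum>i<n. f (z i)) - (\<Sum>i<n. f (w i))\<bar> \<le> C * dist y y' powr \<alpha>"
      unfolding C_def using w(3)
      by (intro birkhoff_sum_holder[OF K(2) K(1) assms(7) ci(1) _ z(1) w(1)]) auto
    moreover have "(\<Sum>i<n. f (w i) - b) \<le> Sup (S y')"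
      using w by (intro cSup_upper bdd) (auto simp: S_def backward_sums_def)
    ultimately show "s \<le> Sup (S y') + C * dist y y' powr \<alpha>"
      using z(3) by (simp add: sum_subtractf)
  qed
  \<comment> \<open>points at distance at least \<open>\<delta>\<close> are covered by the bound \<open>0 \<le> v \<le> B\<close>, whence the second summand\<close>
  define L where "L = C + B / \<delta> powr \<alpha>"
  have L: "L \<ge> C" "L \<ge> B / \<delta> powr \<alpha>" using B(1) C ci by (auto simp: L_def)
  have one: "v y - v y' \<le> L * dist y y' powr \<alpha>" if y: "y \<in> X" "y' \<in> X" for y y'
  proof (cases "dist y y' < \<delta>")
    case True
    have "C * dist y y' powr \<alpha> \<le> L * dist y y' powr \<alpha>" using L by (intro mult_right_mono) auto
    then show ?thesis using near[OF y True] by simp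
  next
    case False
    have "v y - v y' \<le> B" using vB[OF y(1)] v0[OF y(2)] by simp
    also have "\<dots> = B / \<delta> powr \<alpha> * \<delta> powr \<alpha>" using ci by simp
    also have "\<dots> \<le> L * dist y y' powr \<alpha>"
      using L B(1) C ci False assms(7) by (intro mult_mono powr_mono2) auto
    finally show ?thesis .
  qed
  have "holder_on \<alpha> X v"
    unfolding holder_on_def
  proof (intro exI[of _ L] conjI ballI)
    show "L > 0" using L C by simp
    show "\<bar>v z - v z'\<bar> \<le> L * dist z z' powr \<alpha>" if "z \<in> X" "z' \<in> X" for z z'
      using one[OF that] one[OF that(2,1)] by (simp add: dist_commute abs_le_iff)
  qed
  with sub b show ?thesis by (intro exI[of _ v]) auto
qed

end
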